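(* Let $1\le p<\infty$ and let $T$ be a backward unilateral weighted shift on $\ell^p(\mathbb{N})$ with weight sequence $\{w_n\}_{n=1}^\infty$ of positive numbers. If there is a positive integer $m_0$ such that $$\frac{1}{n+2m_0}\le w_{n+m_0}\le\frac1n\qquad\text{for all } n\ge 1,$$ then $\Lambda(T)=[0,1]$.
   Context: $\ell^p(\mathbb{N})$ is the complex Banach space of $p$-summable complex sequences indexed by $\mathbb{N}=\{0,1,2,\dots\}$, with canonical basis $\{e_n\}_{n=0}^\infty$. A backward unilateral weighted shift on $\ell^p(\mathbb{N})$ with weight sequence $\{w_n\}_{n=1}^\infty$ is a bounded linear operator $T$ with $Te_0=0$ and $Te_n=w_ne_{n-1}$ for all $n\ge 1$. A bounded operator $T$ on a complex Banach space $X$ is quasinilpotent if its spectrum is $\{0\}$ (the operator $T$ in the claim is quasinilpotent). For quasinilpotent $T$ and $x\in X\setminus\{0\}$, $$k_x=k_{(T,x)}=\limsup_{z\to 0}\frac{\ln\|(z-T)^{-1}x\|}{\ln\|(z-T)^{-1}\|}$$ ($z\in\mathbb{C}\setminus\{0\}$), and the power set of $T$ is $\Lambda(T)=\{k_x: x\in X\setminus\{0\}\}$. *)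

theory Defs
  imports "HOL-Analysis.Analysis"
begin

text \<open>
  Since the exponent \<open>p\<close> is a term, \<open>\<ell>\<^sup>p(\<nat>)\<close> is a carrier set of sequences with the
  pointwise vector space operations. An operator on it is a function on all sequences of which
  only the values on the carrier matter.
\<close>

definition lp :: "real \<Rightarrow> (nat \<Rightarrow> complex) set" where
  "lp p = {x. summable (\<lambda>n. norm (x n) powr p)}"

definition lp_norm :: "real \<Rightarrow> (nat \<Rightarrow> complex) \<Rightarrow> real" where
  "lp_norm p x = (\<Sum>n. norm (x n) powr p) powr (1 / p)"

definition lp_basis :: "nat \<Rightarrow> nat \<Rightarrow> complex" where
  "lp_basis n = (\<lambda>k. if k = n then 1 else 0)"

definition lp_bounded_operator ::
    "real \<Rightarrow> ((nat \<Rightarrow> complex) \<Rightarrow> (nat \<Rightarrow> complex)) \<Rightarrow> bool" where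
  "lp_bounded_operator p T \<longleftrightarrow>
     (\<forall>x\<in>lp p. T x \<in> lp p) \<and>
     (\<forall>x\<in>lp p. \<forall>y\<in>lp p. T (\<lambda>n. x n + y n) = (\<lambda>n. T x n + T y n)) \<and>
     (\<forall>c. \<forall>x\<in>lp p. T (\<lambda>n. c * x n) = (\<lambda>n. c * T x n)) \<and>
     (\<exists>C. \<forall>x\<in>lp p. lp_norm p (T x) \<le> C * lp_norm p x)"

definition lp_onorm :: "real \<Rightarrow> ((nat \<Rightarrow> complex) \<Rightarrow> (nat \<Rightarrow> complex)) \<Rightarrow> real" where
  "lp_onorm p T = (SUP x\<in>{x\<in>lp p. lp_norm p x \<le> 1}. lp_norm p (T x))"

definition backward_weighted_shift ::
    "real \<Rightarrow> (nat \<Rightarrow> complex) \<Rightarrow> ((nat \<Rightarrow> complex) \<Rightarrow> (nat \<Rightarrow> complex)) \<Rightarrow> bool" where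
  "backward_weighted_shift p w T \<longleftrightarrow>
     lp_bounded_operator p T \<and>
     T (lp_basis 0) = (\<lambda>k. 0) \<and>
     (\<forall>n\<ge>1. T (lp_basis n) = (\<lambda>k. w n * lp_basis (n - 1) k))"

definition scalar_minus ::
    "complex \<Rightarrow> ((nat \<Rightarrow> complex) \<Rightarrow> (nat \<Rightarrow> complex)) \<Rightarrow> (nat \<Rightarrow> complex) \<Rightarrow> (nat \<Rightarrow> complex)" where
  "scalar_minus z T x = (\<lambda>n. z * x n - T x n)"

definition lp_spectrum :: "real \<Rightarrow> ((nat \<Rightarrow> complex) \<Rightarrow> (nat \<Rightarrow> complex)) \<Rightarrow> complex set" where
  "lp_spectrum p T =
     {z. \<not> (\<exists>S. lp_bounded_operator p S \<and>
                 (\<forall>x\<in>lp p. S (scalar_minus z T x) = x) \<and>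
                 (\<forall>x\<in>lp p. scalar_minus z T (S x) = x))}"

definition lp_quasinilpotent :: "real \<Rightarrow> ((nat \<Rightarrow> complex) \<Rightarrow> (nat \<Rightarrow> complex)) \<Rightarrow> bool" where
  "lp_quasinilpotent p T \<longleftrightarrow> lp_bounded_operator p T \<and> lp_spectrum p T = {0}"

text \<open>Only meaningful for \<open>z\<close> outside the spectrum of \<open>T\<close>.\<close>

definition lp_resolvent ::
    "real \<Rightarrow> ((nat \<Rightarrow> complex) \<Rightarrow> (nat \<Rightarrow> complex)) \<Rightarrow> complex \<Rightarrow> (nat \<Rightarrow> complex) \<Rightarrow> (nat \<Rightarrow> complex)" where
  "lp_resolvent p T z = inv_into (lp p) (scalar_minus z T)"

text \<open>
  Only meaningful for quasinilpotent \<open>T\<close> and nonzero \<open>x\<close> in \<open>lp p\<close>. The upper limit is taken in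
  the extended reals; the filter \<open>at 0\<close> excludes \<open>z = 0\<close>.
\<close>

definition local_power ::
    "real \<Rightarrow> ((nat \<Rightarrow> complex) \<Rightarrow> (nat \<Rightarrow> complex)) \<Rightarrow> (nat \<Rightarrow> complex) \<Rightarrow> ereal" where
  "local_power p T x =
     Limsup (at 0) (\<lambda>z. ereal (ln (lp_norm p (lp_resolvent p T z x)) / ln (lp_onorm p (lp_resolvent p T z))))"

definition power_set :: "real \<Rightarrow> ((nat \<Rightarrow> complex) \<Rightarrow> (nat \<Rightarrow> complex)) \<Rightarrow> ereal set" where
  "power_set p T = {local_power p T x |x. x \<in> lp p \<and> x \<noteq> (\<lambda>n. 0)}"

end

theory Submission
  imports Defs
begin

text \<open>
  The proof rests on the observation that the bounds on the weights force \<open>n * w n \<rightarrow> 1\<close>, so that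
  the product of \<open>k\<close> consecutive weights behaves like \<open>1 / fact k\<close> up to factors \<open>Q ^ k\<close> with
  \<open>Q\<close> arbitrarily close to 1: from above uniformly in the starting index
  (\<open>weight_product_upper\<close>), from below for the products starting at the first weight
  (\<open>weight_product_lower\<close>). Inserting this into the Neumann series of the resolvent
  (\<open>shift_resolvent\<close>) turns it into an exponential series.

  From above, Young's convolution inequality gives \<open>C / norm z * exp (Q / norm z)\<close> as a bound for
  the norm of the resolvent at any \<open>z \<noteq> 0\<close>, which also shows that the spectrum is \<open>{0}\<close>, where 0 is
  an eigenvalue. From below, one tests with the vector \<open>1 / (k + 1)\<^sup>2\<close>, rotated by the phases of
  \<open>z\<close>. Together, \<open>norm z\<close> times the logarithm of the resolvent norm tends to 1
  (\<open>log_onorm_resolvent_tendsto\<close>), and the local power of \<open>x\<close> is the upper limit of \<open>norm z\<close>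
  times the logarithm of the norm of the resolvent vector of \<open>x\<close>.

  Every such upper limit lies in \<open>[0, 1]\<close>: it is at most 1 by the bound on the resolvent, and
  nonnegative because resolvent vectors of \<open>x \<noteq> 0\<close> stay away from zero near \<open>z = 0\<close>. A given
  \<open>t\<close> in \<open>[0, 1]\<close> is attained at the vector \<open>t ^ k / (k + 1)\<^sup>2\<close> (\<open>local_power_probe\<close>): its
  geometric factor replaces \<open>1 / norm z\<close> by \<open>t / norm z\<close> in the exponential series, in the
  upper bound for all \<open>z\<close> and in the lower bound for positive real \<open>z\<close>.
\<close>

section \<open>The spaces of p-summable sequences\<close>

lemma lp_norm_nonneg: "0 \<le> lp_norm p x"
  by (simp add: lp_norm_def)

lemma lp_norm_powr:
  assumes "1 \<le> p" "x \<in> lp p"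
  shows "lp_norm p x powr p = (\<Sum>n. norm (x n) powr p)"
proof -
  have "0 \<le> (\<Sum>n. norm (x n) powr p)"
    using assms(2) by (auto simp: lp_def intro!: suminf_nonneg)
  then show ?thesis
    using assms(1) by (simp add: lp_norm_def powr_powr)
qed

lemma norm_le_lp_norm:
  assumes "1 \<le> p" "x \<in> lp p"
  shows "norm (x n) \<le> lp_norm p x"
proof -
  have "norm (x n) powr p = (\<Sum>i\<in>{n}. norm (x i) powr p)" by simp
  also have "\<dots> \<le> (\<Sum>n. norm (x n) powr p)"
    using assms(2) unfolding lp_def by (intro sum_le_suminf) auto
  also have "\<dots> = lp_norm p x powr p"
    using assms by (simp add: lp_norm_powr)
  finally show ?thesis
    using assms(1) lp_norm_nonneg powr_less_mono2 by (metis less_le_trans not_le zero_less_one)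
qed

lemma lp_norm_pos:
  assumes "1 \<le> p" "x \<in> lp p" "x \<noteq> (\<lambda>n. 0)"
  shows "0 < lp_norm p x"
proof -
  obtain n where "x n \<noteq> 0" using assms(3) by auto
  then show ?thesis
    using norm_le_lp_norm[OF assms(1,2), of n] by (smt (verit) zero_less_norm_iff)
qed

lemma lp_bound_from_partial_sums:
  assumes "1 \<le> p" "0 \<le> K" "\<And>M. (\<Sum>n<M. norm (y n) powr p) \<le> K powr p"
  shows "y \<in> lp p" "lp_norm p y \<le> K"
proof -
  show y: "y \<in> lp p"
    unfolding lp_def mem_Collect_eq using assms(3) by (intro summableI_nonneg_bounded) auto
  have "lp_norm p y powr p \<le> K powr p"
    unfolding lp_norm_powr[OF assms(1) y] using y assms(3)
    by (intro suminf_le_const) (auto simp: lp_def)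
  then show "lp_norm p y \<le> K"
    using assms(1,2) powr_less_mono2 by (metis less_le_trans not_le zero_less_one)
qed

lemma lp_dominated:
  assumes "1 \<le> p" "x \<in> lp p" "0 \<le> c" "\<And>n. norm (y n) \<le> c * norm (x n)"
  shows "y \<in> lp p" "lp_norm p y \<le> c * lp_norm p x"
proof -
  have "(\<Sum>n<M. norm (y n) powr p) \<le> (c * lp_norm p x) powr p" for M
  proof -
    have "(\<Sum>n<M. norm (y n) powr p) \<le> (\<Sum>n<M. c powr p * norm (x n) powr p)"
      using assms by (intro sum_mono) (simp flip: powr_mult add: powr_mono2)
    also have "\<dots> \<le> c powr p * (\<Sum>n. norm (x n) powr p)"
      unfolding sum_distrib_left[symmetric] using assms(2)
      by (intro mult_left_mono sum_le_suminf) (auto simp: lp_def)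
    also have "\<dots> = (c * lp_norm p x) powr p"
      using assms lp_norm_nonneg by (simp add: lp_norm_powr powr_mult)
    finally show ?thesis .
  qed
  with assms show "y \<in> lp p" "lp_norm p y \<le> c * lp_norm p x"
    using lp_bound_from_partial_sums[OF assms(1), of "c * lp_norm p x" y]
    by (simp_all add: lp_norm_nonneg)
qed

lemma lp_scale:
  assumes "1 \<le> p" "x \<in> lp p"
  shows "(\<lambda>n. c * x n) \<in> lp p" "lp_norm p (\<lambda>n. c * x n) \<le> norm c * lp_norm p x"
  using lp_dominated[OF assms, of "norm c" "\<lambda>n. c * x n"] by (simp_all add: norm_mult)

lemma lp_finite_support:
  assumes "finite {n. x n \<noteq> 0}"
  shows "x \<in> lp p"
  unfolding lp_def mem_Collect_eq
  by (rule summable_finite[OF assms]) auto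

text \<open>
  This is where \<open>p < \<infinity>\<close> enters: truncations of \<open>x\<close> converge to \<open>x\<close> in norm, so a bounded
  operator is determined by its values on the canonical basis.
\<close>

lemma lp_tail_tendsto_0:
  assumes "1 \<le> p" "x \<in> lp p"
  shows "(\<lambda>N. lp_norm p (\<lambda>k. if k < N then 0 else x k)) \<longlonglongrightarrow> 0"
proof -
  let ?f = "\<lambda>k. norm (x k) powr p"
  have s: "summable ?f" using assms by (simp add: lp_def)
  have "(\<Sum>k. norm (if k < N then 0 else x k) powr p) = (\<Sum>k. ?f k) - (\<Sum>k<N. ?f k)" for N
  proof -
    have "(\<lambda>k. if k \<in> {..<N} then ?f k else 0) sums (\<Sum>k<N. ?f k)"
      by (rule sums_If_finite_set) simp
    then have "(\<lambda>k. ?f k - (if k \<in> {..<N} then ?f k else 0)) sums ((\<Sum>k. ?f k) - (\<Sum>k<N. ?f k))"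
      using s by (intro sums_diff summable_sums)
    moreover have "(\<lambda>k. ?f k - (if k \<in> {..<N} then ?f k else 0))
        = (\<lambda>k. norm (if k < N then 0 else x k) powr p)"
      by auto
    ultimately show ?thesis by (simp add: sums_iff)
  qed
  then have "lp_norm p (\<lambda>k. if k < N then 0 else x k)
      = ((\<Sum>k. ?f k) - (\<Sum>k<N. ?f k)) powr (1 / p)" for N
    by (simp add: lp_norm_def)
  moreover have "(\<lambda>N. ((\<Sum>k. ?f k) - (\<Sum>k<N. ?f k)) powr (1 / p)) \<longlonglongrightarrow> 0 powr (1 / p)"
  proof (rule tendsto_powr2)
    show "(\<lambda>N. (\<Sum>k. ?f k) - (\<Sum>k<N. ?f k)) \<longlonglongrightarrow> 0"
      using tendsto_diff[OF tendsto_const summable_LIMSEQ[OF s], of "\<Sum>k. ?f k"] by simp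
    show "\<forall>\<^sub>F N in sequentially. 0 \<le> (\<Sum>k. ?f k) - (\<Sum>k<N. ?f k)"
      using s by (auto intro!: sum_le_suminf always_eventually)
  qed (use assms in auto)
  ultimately show ?thesis by simp
qed

text \<open>
  Jensen's inequality for the convex function \<open>v powr p\<close>. With \<open>m\<close> the weighted mean of the
  \<open>v k\<close>, Young's inequality bounds \<open>v k * m powr (p - 1)\<close> by a combination of \<open>v k powr p\<close> and
  \<open>m powr p\<close>, and after summation only the two sides of the claim survive.
\<close>

lemma suminf_powr_le:
  fixes a v :: "nat \<Rightarrow> real"
  assumes p: "1 \<le> p" and a: "\<And>k. 0 \<le> a k" "summable a" and v: "\<And>k. 0 \<le> v k"
    and av: "summable (\<lambda>k. a k * v k)" "summable (\<lambda>k. a k * v k powr p)"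
  shows "(\<Sum>k. a k * v k) powr p \<le> (\<Sum>k. a k) powr (p - 1) * (\<Sum>k. a k * v k powr p)"
proof (cases "(\<Sum>k. a k * v k) = 0")
  case True
  then show ?thesis
    using p a v av by (auto intro!: mult_nonneg_nonneg suminf_nonneg)
next
  case False
  define S where "S = (\<Sum>k. a k)"
  define m where "m = (\<Sum>k. a k * v k) / S"
  have avpos: "0 < (\<Sum>k. a k * v k)"
    using False suminf_nonneg[OF av(1)] a v by (simp add: less_le)
  have S0: "S \<noteq> 0"
  proof
    assume "S = 0"
    then have "a = (\<lambda>k. 0)"
      using suminf_eq_zero_iff[OF a(2)] a(1) by (auto simp: S_def)
    then show False using avpos by simp
  qed
  then have S: "0 < S" using suminf_nonneg[OF a(2)] a(1) by (simp add: S_def less_le)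
  have m: "0 < m" using avpos S by (simp add: m_def)
  have young: "v k * m powr (p - 1) \<le> v k powr p / p + (1 - 1 / p) * m powr p" for k
  proof (cases "v k = 0")
    case True
    then show ?thesis using p by simp
  next
    case False
    then have vk: "0 < v k" using v[of k] by simp
    have "(v k powr p) powr (1 / p) * (m powr p) powr (1 - 1 / p)
        \<le> 1 / p * (v k powr p) + (1 - 1 / p) * m powr p"
      using p vk m by (intro Youngs_inequality_0) auto
    moreover have "p * (1 - 1 / p) = p - 1" using p by (simp add: field_simps)
    ultimately show ?thesis using p vk by (simp add: powr_powr)
  qed
  \<comment> \<open>Summing \<open>young\<close> with weights \<open>a k\<close> turns the left side into \<open>S * m powr p\<close>.\<close>
  have "(\<Sum>k. a k * v k) * m powr (p - 1) = (\<Sum>k. a k * (v k * m powr (p - 1)))"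
    using suminf_mult2[OF av(1), of "m powr (p - 1)"] by (simp add: mult_ac)
  also have "\<dots> \<le> (\<Sum>k. a k * v k powr p * (1 / p) + a k * ((1 - 1 / p) * m powr p))"
  proof (rule suminf_le)
    fix k
    show "a k * (v k * m powr (p - 1)) \<le> a k * v k powr p * (1 / p) + a k * ((1 - 1 / p) * m powr p)"
      using mult_left_mono[OF young a(1)[of k]] by (simp add: algebra_simps)
  next
    show "summable (\<lambda>k. a k * (v k * m powr (p - 1)))"
      using summable_mult2[OF av(1), of "m powr (p - 1)"] by (simp add: mult_ac)
    show "summable (\<lambda>k. a k * v k powr p * (1 / p) + a k * ((1 - 1 / p) * m powr p))"
      by (intro summable_add summable_mult2 a av)
  qed
  also have "\<dots> = (\<Sum>k. a k * v k powr p) * (1 / p) + S * ((1 - 1 / p) * m powr p)"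
    unfolding S_def using a av
    by (subst suminf_add[symmetric]) (auto intro!: summable_mult2 summable_divide simp: suminf_mult2 suminf_divide)
  also have "(\<Sum>k. a k * v k) * m powr (p - 1) = S * m powr p"
  proof -
    have "(\<Sum>k. a k * v k) = S * m" using S by (simp add: m_def)
    then show ?thesis using m powr_mult_base[of m "p - 1"] by (simp add: mult.assoc)
  qed
  finally have "S * m powr p \<le> (\<Sum>k. a k * v k powr p) * (1 / p) + S * ((1 - 1 / p) * m powr p)" .
  then have "S * m powr p \<le> (\<Sum>k. a k * v k powr p)"
    using p by (simp add: field_simps)
  then have "S powr (p - 1) * (S * m powr p) \<le> S powr (p - 1) * (\<Sum>k. a k * v k powr p)"
    by (intro mult_left_mono) auto
  moreover have "S powr (p - 1) * (S * m powr p) = (S * m) powr p"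
    using S m powr_mult_base[of S "p - 1"] by (simp add: powr_mult mult_ac)
  moreover have "S * m = (\<Sum>k. a k * v k)" using S by (simp add: m_def)
  ultimately show ?thesis by (simp add: S_def)
qed

text \<open>
  Young's convolution inequality for the correlation of \<open>x\<close> with a summable sequence: Jensen's
  inequality in each coordinate, then the order of summation is exchanged.
\<close>

lemma lp_correlation_bound:
  assumes p: "1 \<le> p" and a: "\<And>k. 0 \<le> a k" "summable a" and x: "x \<in> lp p"
    and y: "\<And>n. norm (y n) \<le> (\<Sum>k. a k * norm (x (n + k)))"
  shows "y \<in> lp p" "lp_norm p y \<le> (\<Sum>k. a k) * lp_norm p x"
proof -
  let ?S = "\<Sum>k. a k" and ?X = "lp_norm p x"
  have S: "0 \<le> ?S" using a by (intro suminf_nonneg) auto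
  have sx: "summable (\<lambda>k. a k * norm (x (n + k)))" for n
    using a x p by (intro summable_comparison_test'[OF summable_mult2[OF a(2), of ?X], of 0])
      (auto intro!: mult_left_mono norm_le_lp_norm)
  have sxp: "summable (\<lambda>k. a k * norm (x (n + k)) powr p)" for n
    using a x p by (intro summable_comparison_test'[OF summable_mult2[OF a(2), of "?X powr p"], of 0])
      (auto intro!: mult_left_mono powr_mono2 norm_le_lp_norm)
  have "(\<Sum>n<M. norm (y n) powr p) \<le> (?S * ?X) powr p" for M
  proof -
    have "(\<Sum>n<M. norm (y n) powr p) \<le> (\<Sum>n<M. ?S powr (p - 1) * (\<Sum>k. a k * norm (x (n + k)) powr p))"
    proof (rule sum_mono)
      fix n
      have "norm (y n) powr p \<le> (\<Sum>k. a k * norm (x (n + k))) powr p"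
        using p y by (intro powr_mono2) auto
      also have "\<dots> \<le> ?S powr (p - 1) * (\<Sum>k. a k * norm (x (n + k)) powr p)"
        using sx sxp p a by (intro suminf_powr_le) auto
      finally show "norm (y n) powr p \<le> ?S powr (p - 1) * (\<Sum>k. a k * norm (x (n + k)) powr p)" .
    qed
    also have "\<dots> = ?S powr (p - 1) * (\<Sum>k. \<Sum>n<M. a k * norm (x (n + k)) powr p)"
      by (subst suminf_sum) (auto simp: sum_distrib_left sxp)
    also have "\<dots> \<le> ?S powr (p - 1) * (\<Sum>k. a k * ?X powr p)"
    proof (intro mult_left_mono suminf_le)
      fix k
      have "(\<Sum>n<M. norm (x (n + k)) powr p) = (\<Sum>n\<in>(\<lambda>n. n + k) ` {..<M}. norm (x n) powr p)"
        by (subst sum.reindex) auto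
      also have "\<dots> \<le> (\<Sum>n. norm (x n) powr p)"
        using x by (intro sum_le_suminf) (auto simp: lp_def)
      finally have "(\<Sum>n<M. norm (x (n + k)) powr p) \<le> ?X powr p"
        using x p by (simp add: lp_norm_powr)
      then show "(\<Sum>n<M. a k * norm (x (n + k)) powr p) \<le> a k * ?X powr p"
        unfolding sum_distrib_left[symmetric] using a by (intro mult_left_mono)
    qed (auto intro!: summable_sum sxp summable_mult2 a)
    also have "\<dots> = (?S powr (p - 1) * ?S) * ?X powr p"
      using a by (simp add: suminf_mult2)
    also have "\<dots> = (?S * ?X) powr p"
    proof (cases "?S = 0")
      case False
      then show ?thesis
        using S powr_mult_base[of ?S "p - 1"] lp_norm_nonneg by (simp add: powr_mult mult_ac)
    qed (use p in auto)
    finally show ?thesis .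
  qed
  then show "y \<in> lp p" "lp_norm p y \<le> ?S * ?X"
    using lp_bound_from_partial_sums[OF p, of "?S * ?X" y] S lp_norm_nonneg by auto
qed

section \<open>Products of weights compared with inverse factorials\<close>

definition weight_product :: "(nat \<Rightarrow> real) \<Rightarrow> nat \<Rightarrow> nat \<Rightarrow> real" where
  "weight_product w n k = (\<Prod>i<k. w (n + i + 1))"

lemma weight_product_0 [simp]: "weight_product w n 0 = 1"
  by (simp add: weight_product_def)

lemma weight_product_Suc: "weight_product w n (Suc k) = weight_product w n k * w (n + k + 1)"
  by (simp add: weight_product_def)

lemma weight_product_Suc_shift: "weight_product w n (Suc k) = w (n + 1) * weight_product w (Suc n) k"
  by (simp add: weight_product_def prod.lessThan_Suc_shift del: prod.lessThan_Suc)

text \<open>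
  Dividing \<open>u k * fact k\<close> by \<open>q ^ k\<close> gives a sequence that increases from some index on,
  because its successive ratios tend to \<open>1 / q > 1\<close>. Its minimum over the initial segment is
  therefore a lower bound everywhere.
\<close>

lemma factorial_lower_bound:
  fixes u :: "nat \<Rightarrow> real"
  assumes u: "\<And>k. 0 < u k" and lim: "(\<lambda>k. real (k + 1) * u (k + 1) / u k) \<longlonglongrightarrow> 1"
    and q: "0 < q" "q < 1"
  shows "\<exists>c>0. \<forall>k. c * q ^ k / fact k \<le> u k"
proof -
  define r where "r k = u k * fact k / q ^ k" for k
  have "\<forall>\<^sub>F k in sequentially. q < real (k + 1) * u (k + 1) / u k"
    using lim q(2) by (rule order_tendstoD)
  then obtain j where j: "\<And>k. j \<le> k \<Longrightarrow> q < real (k + 1) * u (k + 1) / u k"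
    by (auto simp: eventually_sequentially)
  have mono_step: "r k \<le> r (Suc k)" if "j \<le> k" for k
  proof -
    have "q * u k \<le> real (k + 1) * u (k + 1)"
      using j[OF that] u[of k] by (simp add: pos_less_divide_eq)
    then have "q * u k * (fact k / q ^ Suc k) \<le> real (k + 1) * u (k + 1) * (fact k / q ^ Suc k)"
      using q by (intro mult_right_mono) auto
    then show ?thesis using q by (simp add: r_def field_simps)
  qed
  define c where "c = Min (r ` {..j})"
  have "0 < c" using u q by (simp add: c_def r_def)
  moreover have "c \<le> r k" for k
  proof (cases "k \<le> j")
    case True
    then show ?thesis by (simp add: c_def)
  next
    case False
    have "j \<le> k" using False by simp
    then have "r j \<le> r k"
    proof (induction k rule: dec_induct)
      case (step n)
      then show ?case using \<open>r j \<le> r n\<close> mono_step[of n] by simp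
    qed simp
    moreover have "c \<le> r j" by (simp add: c_def)
    ultimately show ?thesis by simp
  qed
  ultimately show ?thesis
    using q by (intro exI[of _ c]) (auto simp: r_def field_simps)
qed

text \<open>
  All asymptotic statements depend on the weights only through \<open>n * w n \<rightarrow> 1\<close>; the two-sided
  bound of the theorem serves to establish this limit.
\<close>

locale harmonic_weights =
  fixes w :: "nat \<Rightarrow> real"
  assumes w_pos: "\<And>n. 1 \<le> n \<Longrightarrow> 0 < w n"
    and w_lim: "(\<lambda>n. real n * w n) \<longlonglongrightarrow> 1"
begin

lemma weight_product_pos: "0 < weight_product w n k"
  unfolding weight_product_def by (intro prod_pos) (auto intro: w_pos)

text \<open>
  Multiplying by \<open>fact k\<close> pairs the weight \<open>w (n + i)\<close> with the number \<open>i \<le> n + i\<close>, so each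
  factor is at most \<open>(n + i) * w (n + i)\<close>. These numbers are at most \<open>Q\<close> from some index \<open>j\<close>
  on, and bounded by a constant before; at most \<open>j\<close> factors are of the latter kind, so the
  resulting bound is uniform in \<open>n\<close>.
\<close>

lemma weight_product_upper:
  assumes Q: "1 < Q"
  shows "\<exists>C>0. \<forall>n k. weight_product w n k \<le> C * Q ^ k / fact k"
proof -
  have "\<forall>\<^sub>F n in sequentially. real n * w n < Q"
    using w_lim Q by (rule order_tendstoD)
  then obtain j where j: "\<And>n. j \<le> n \<Longrightarrow> real n * w n < Q"
    by (auto simp: eventually_sequentially)
  obtain L where L: "1 \<le> L" "\<And>n. real n * w n \<le> L"
  proof -
    have "Bseq (\<lambda>n. real n * w n)"
      using w_lim by (intro convergent_imp_Bseq convergentI)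
    then obtain K where "\<And>n. norm (real n * w n) \<le> K" by (metis BseqE)
    then show ?thesis by (intro that[of "max 1 K"]) (auto simp: abs_le_iff le_max_iff_disj)
  qed
  have "weight_product w n k * fact k \<le> L ^ min k j * Q ^ k" for n k
  proof (induction k)
    case (Suc k)
    have factor: "real (k + 1) * w (n + k + 1) \<le> (if k < j then L else 1) * Q"
    proof -
      have "real (k + 1) * w (n + k + 1) \<le> real (n + k + 1) * w (n + k + 1)"
        using w_pos[of "n + k + 1"] by (intro mult_right_mono) auto
      moreover have "L \<le> L * Q" using L(1) Q by simp
      ultimately show ?thesis
        using L(2)[of "n + k + 1"] j[of "n + k + 1"] by (cases "k < j") auto
    qed
    have "weight_product w n (Suc k) * fact (Suc k)
        = (weight_product w n k * fact k) * (real (k + 1) * w (n + k + 1))"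
      by (simp add: weight_product_Suc algebra_simps)
    also have "\<dots> \<le> (L ^ min k j * Q ^ k) * ((if k < j then L else 1) * Q)"
      using L Q w_pos[of "n + k + 1"] by (intro mult_mono Suc.IH factor) auto
    also have "\<dots> = L ^ min (Suc k) j * Q ^ Suc k"
      by (auto simp: min_def not_less_eq_eq le_Suc_eq)
    finally show ?case .
  qed simp
  also have "L ^ min k j * Q ^ k \<le> L ^ j * Q ^ k" for k
    using L Q by (intro mult_right_mono power_increasing) auto
  finally have "weight_product w n k \<le> L ^ j * Q ^ k / fact k" for n k
    by (simp add: pos_le_divide_eq)
  then show ?thesis using L by (intro exI[of _ "L ^ j"]) auto
qed

text \<open>
  The factor \<open>(k + 1)\<^sup>2\<close> is the denominator in the vectors \<open>probe\<close> below; it is absorbed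
  because the quotients of its consecutive values tend to 1.
\<close>

lemma weight_product_lower:
  assumes "0 < q" "q < 1"
  shows "\<exists>c>0. \<forall>k. c * q ^ k / fact k \<le> weight_product w 0 k / (real k + 1)\<^sup>2"
proof (rule factorial_lower_bound[OF _ _ assms])
  fix k show "0 < weight_product w 0 k / (real k + 1)\<^sup>2"
    using weight_product_pos by simp
next
  have "real (k + 1) * (weight_product w 0 (k + 1) / (real (k + 1) + 1)\<^sup>2)
        / (weight_product w 0 k / (real k + 1)\<^sup>2)
      = real (k + 1) * w (k + 1) * ((real k + 1) / (real k + 2))\<^sup>2" for k
    using weight_product_pos[of 0 k]
    by (simp add: weight_product_Suc power_divide add.commute mult_ac)
  moreover have "(\<lambda>k. real (k + 1) * w (k + 1) * ((real k + 1) / (real k + 2))\<^sup>2) \<longlonglongrightarrow> 1 * 1\<^sup>2"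
  proof (intro tendsto_mult tendsto_power)
    show "(\<lambda>k. real (k + 1) * w (k + 1)) \<longlonglongrightarrow> 1"
      using LIMSEQ_ignore_initial_segment[OF w_lim, of 1] by simp
    show "(\<lambda>k. (real k + 1) / (real k + 2)) \<longlonglongrightarrow> 1"
      using LIMSEQ_Suc[OF LIMSEQ_n_over_Suc_n] by (simp add: add_ac)
  qed
  ultimately show "(\<lambda>k. real (k + 1) * (weight_product w 0 (k + 1) / (real (k + 1) + 1)\<^sup>2)
        / (weight_product w 0 k / (real k + 1)\<^sup>2)) \<longlonglongrightarrow> 1"
    by simp
qed

end

section \<open>The resolvent of the shift\<close>

text \<open>
  The exponential series is written with the powers of \<open>r\<close> in the form in which they occur in
  the Neumann series of the resolvent. With the default value of division the identity holds for
  \<open>r = 0\<close> as well.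
\<close>

lemma exp_majorant_sums:
  fixes C r Q :: real
  shows "(\<lambda>k. C * Q ^ k / fact k / r ^ (k + 1)) sums (C / r * exp (Q / r))"
proof -
  have "(\<lambda>k. C / r * ((Q / r) ^ k /\<^sub>R fact k)) sums (C / r * exp (Q / r))"
    by (intro sums_mult exp_converges)
  then show ?thesis by (simp add: field_simps)
qed

text \<open>
  The \<open>n\<close>-th coordinate of the Neumann series \<open>(\<Sum>k. T ^^ k x / z ^ (k + 1))\<close>.
\<close>

definition shift_resolvent :: "(nat \<Rightarrow> real) \<Rightarrow> complex \<Rightarrow> (nat \<Rightarrow> complex) \<Rightarrow> nat \<Rightarrow> complex" where
  "shift_resolvent w z x n = (\<Sum>k. complex_of_real (weight_product w n k) * x (n + k) / z ^ (k + 1))"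

locale harmonic_shift = harmonic_weights +
  fixes p :: real and T :: "(nat \<Rightarrow> complex) \<Rightarrow> (nat \<Rightarrow> complex)"
  assumes p: "1 \<le> p" and T: "backward_weighted_shift p (\<lambda>n. complex_of_real (w n)) T"
begin

lemma bounded_T: "lp_bounded_operator p T"
  using T by (simp add: backward_weighted_shift_def)

lemma T_in_lp: "x \<in> lp p \<Longrightarrow> T x \<in> lp p"
  using bounded_T by (simp add: lp_bounded_operator_def)

lemma T_add: "x \<in> lp p \<Longrightarrow> y \<in> lp p \<Longrightarrow> T (\<lambda>n. x n + y n) = (\<lambda>n. T x n + T y n)"
  using bounded_T by (simp add: lp_bounded_operator_def)

lemma T_scale: "x \<in> lp p \<Longrightarrow> T (\<lambda>n. c * x n) = (\<lambda>n. c * T x n)"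
  using bounded_T by (simp add: lp_bounded_operator_def)

text \<open>
  On finitely supported vectors the action of \<open>T\<close> follows from linearity alone.
\<close>

lemma T_truncation:
  fixes x :: "nat \<Rightarrow> complex"
  shows "T (\<lambda>k. if k < N then x k else 0) = (\<lambda>n. if n + 1 < N then w (n + 1) * x (n + 1) else 0)"
proof (induction N)
  case 0
  show ?case using T_scale[of "\<lambda>n. 0" 0] lp_finite_support[of "\<lambda>n. 0"] by simp
next
  case (Suc N)
  have basis: "lp_basis N \<in> lp p" by (rule lp_finite_support) (simp add: lp_basis_def)
  have "(\<lambda>k. if k < Suc N then x k else 0)
      = (\<lambda>k. (if k < N then x k else 0) + x N * lp_basis N k)"
    by (auto simp: lp_basis_def less_Suc_eq)
  then have "T (\<lambda>k. if k < Suc N then x k else 0)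
      = (\<lambda>n. (if n + 1 < N then w (n + 1) * x (n + 1) else 0) + x N * T (lp_basis N) n)"
    by (simp add: T_add lp_scale basis p T_scale lp_finite_support Suc.IH)
  moreover have "T (lp_basis N) = (\<lambda>n. if n + 1 = N then w N else 0)"
    using T by (cases N) (auto simp: backward_weighted_shift_def lp_basis_def)
  ultimately show ?case by (auto simp: less_Suc_eq)
qed

lemma T_apply:
  fixes x :: "nat \<Rightarrow> complex"
  assumes x: "x \<in> lp p"
  shows "T x n = w (n + 1) * x (n + 1)"
proof -
  obtain C where C: "\<And>y. y \<in> lp p \<Longrightarrow> lp_norm p (T y) \<le> C * lp_norm p y"
    using bounded_T unfolding lp_bounded_operator_def by blast
  let ?tail = "\<lambda>N k. if k < N then 0 else x k"
  have tail: "?tail N \<in> lp p" for N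
    using lp_dominated(1)[OF p x, of 1] by simp
  have "norm (T x n - w (n + 1) * x (n + 1)) \<le> C * lp_norm p (?tail N)" if "n + 1 < N" for N
  proof -
    have "T x = T (\<lambda>k. (if k < N then x k else 0) + ?tail N k)"
      by (rule arg_cong[where f = T]) auto
    also have "\<dots> = (\<lambda>n. (if n + 1 < N then w (n + 1) * x (n + 1) else 0) + T (?tail N) n)"
      by (simp add: T_add lp_finite_support tail T_truncation)
    finally have "T x n - w (n + 1) * x (n + 1) = T (?tail N) n"
      using that by simp
    then show ?thesis
      using norm_le_lp_norm[OF p T_in_lp[OF tail[of N]], of n] C[OF tail[of N]] by simp
  qed
  then have "\<forall>\<^sub>F N in sequentially. norm (T x n - w (n + 1) * x (n + 1)) \<le> C * lp_norm p (?tail N)"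
    by (intro eventually_sequentiallyI[of "n + 2"]) auto
  moreover have "(\<lambda>N. C * lp_norm p (?tail N)) \<longlonglongrightarrow> C * 0"
    by (intro tendsto_mult tendsto_const lp_tail_tendsto_0 p x)
  ultimately have "norm (T x n - w (n + 1) * x (n + 1)) \<le> C * 0"
    by (intro tendsto_lowerbound) auto
  then show ?thesis by simp
qed

lemma norm_resolvent_term:
  assumes "\<And>n k. weight_product w n k \<le> C * Q ^ k / fact k"
  shows "norm (complex_of_real (weight_product w n k) * x / z ^ (k + 1))
    \<le> C * Q ^ k / fact k / norm z ^ (k + 1) * norm x"
  using weight_product_pos[of n k] mult_right_mono[OF assms[of n k], of "norm x / norm z ^ (k + 1)"]
  by (simp add: norm_mult norm_divide norm_power)

lemma resolvent_term_summable:
  assumes x: "x \<in> lp p"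
  shows "summable (\<lambda>k. norm (complex_of_real (weight_product w n k) * x (n + k) / z ^ (k + 1)))"
proof -
  obtain C where C: "0 < C" "\<And>n k. weight_product w n k \<le> C * 2 ^ k / fact k"
    using weight_product_upper[of 2] by auto
  show ?thesis
  proof (rule summable_comparison_test'[of _ 0])
    show "summable (\<lambda>k. C * 2 ^ k / fact k / norm z ^ (k + 1) * lp_norm p x)"
      using sums_summable[OF exp_majorant_sums[of C 2 "norm z"]] by (rule summable_mult2)
    fix k
    have "norm (complex_of_real (weight_product w n k) * x (n + k) / z ^ (k + 1))
        \<le> C * 2 ^ k / fact k / norm z ^ (k + 1) * norm (x (n + k))"
      by (rule norm_resolvent_term[OF C(2)])
    also have "\<dots> \<le> C * 2 ^ k / fact k / norm z ^ (k + 1) * lp_norm p x"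
      using C(1) norm_le_lp_norm[OF p x] by (intro mult_left_mono) auto
    finally show "norm (norm (complex_of_real (weight_product w n k) * x (n + k) / z ^ (k + 1)))
        \<le> C * 2 ^ k / fact k / norm z ^ (k + 1) * lp_norm p x"
      by simp
  qed
qed

lemmas resolvent_term_summable' = summable_norm_cancel[OF resolvent_term_summable]

text \<open>
  The Neumann series is dominated coordinatewise by the correlation of \<open>norm \<circ> x\<close> with the
  coefficients of an exponential series, so Young's inequality bounds it on \<open>\<ell>\<^sup>p\<close> by the sum of that
  series.
\<close>

lemma resolvent_bound:
  assumes C: "0 < C" "0 < Q" "\<And>n k. weight_product w n k \<le> C * Q ^ k / fact k"
    and x: "x \<in> lp p"
  shows "shift_resolvent w z x \<in> lp p"
    and "lp_norm p (shift_resolvent w z x) \<le> C / norm z * exp (Q / norm z) * lp_norm p x"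
proof -
  let ?a = "\<lambda>k. C * Q ^ k / fact k / norm z ^ (k + 1)"
  have a: "summable ?a" "(\<Sum>k. ?a k) = C / norm z * exp (Q / norm z)"
    using exp_majorant_sums[of C Q "norm z"] by (simp_all add: sums_iff)
  have a0: "0 \<le> ?a k" for k using C by simp
  have "norm (shift_resolvent w z x n) \<le> (\<Sum>k. ?a k * norm (x (n + k)))" for n
    unfolding shift_resolvent_def
  proof (rule norm_suminf_le)
    show "summable (\<lambda>k. ?a k * norm (x (n + k)))"
      using a0 x p by (intro summable_comparison_test'[OF summable_mult2[OF a(1), of "lp_norm p x"], of 0])
        (auto simp del: times_divide_eq_left times_divide_eq_right intro!: mult_left_mono norm_le_lp_norm)
  qed (rule norm_resolvent_term[OF C(3)])
  from lp_correlation_bound[OF p a0 a(1) x this] a(2)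
  show "shift_resolvent w z x \<in> lp p"
    "lp_norm p (shift_resolvent w z x) \<le> C / norm z * exp (Q / norm z) * lp_norm p x"
    by simp_all
qed

lemma shift_resolvent_in_lp: "x \<in> lp p \<Longrightarrow> shift_resolvent w z x \<in> lp p"
  using weight_product_upper[of 2] resolvent_bound(1)[of _ 2 x z] by auto

lemma resolvent_right_inverse:
  assumes z: "z \<noteq> 0" and x: "x \<in> lp p"
  shows "scalar_minus z T (shift_resolvent w z x) = x"
proof
  fix n
  let ?f = "\<lambda>k. complex_of_real (weight_product w n k) * x (n + k) / z ^ (k + 1)"
  let ?g = "\<lambda>k. complex_of_real (weight_product w (Suc n) k) * x (Suc n + k) / z ^ (k + 1)"
  have "w (n + 1) * shift_resolvent w z x (n + 1) = (\<Sum>k. w (n + 1) * ?g k)"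
    unfolding shift_resolvent_def using resolvent_term_summable'[OF x, of "Suc n" z]
    by (simp only: suminf_mult add_Suc_right Suc_eq_plus1 [symmetric] add_0_right)
  also have "\<dots> = (\<Sum>k. z * ?f (Suc k))"
    using z by (intro suminf_cong) (simp add: weight_product_Suc_shift field_simps)
  also have "\<dots> = z * (\<Sum>k. ?f (Suc k))"
    by (intro suminf_mult iffD2[OF summable_Suc_iff[of ?f]] resolvent_term_summable' x)
  also have "\<dots> = z * (shift_resolvent w z x n - x n / z)"
    using suminf_split_head[OF resolvent_term_summable'[OF x, of n z]]
    by (simp add: shift_resolvent_def)
  finally show "scalar_minus z T (shift_resolvent w z x) n = x n"
    using z by (simp add: scalar_minus_def T_apply shift_resolvent_in_lp x algebra_simps)
qed

text \<open>
  Substituting \<open>z x - T x\<close> into the series makes it telescope; the boundary term vanishes because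
  it is a general term of a convergent series.
\<close>

lemma resolvent_left_inverse:
  assumes z: "z \<noteq> 0" and x: "x \<in> lp p"
  shows "shift_resolvent w z (scalar_minus z T x) = x"
proof
  fix n
  let ?u = "\<lambda>k. complex_of_real (weight_product w n k) * x (n + k) / z ^ k"
  have "summable (\<lambda>k. z * (complex_of_real (weight_product w n k) * x (n + k) / z ^ (k + 1)))"
    by (intro summable_mult resolvent_term_summable' x)
  then have "?u \<longlonglongrightarrow> 0"
    using z by (intro summable_LIMSEQ_zero) (simp add: field_simps)
  then have "(\<lambda>k. ?u k - ?u (Suc k)) sums (?u 0 - 0)"
    by (rule telescope_sums')
  moreover have "complex_of_real (weight_product w n k) * scalar_minus z T x (n + k) / z ^ (k + 1)
      = ?u k - ?u (Suc k)" for k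
    using z by (simp add: scalar_minus_def T_apply x weight_product_Suc field_simps)
  ultimately show "shift_resolvent w z (scalar_minus z T x) n = x n"
    unfolding shift_resolvent_def by (simp add: sums_iff)
qed

lemma lp_resolvent_eq:
  assumes z: "z \<noteq> 0" and x: "x \<in> lp p"
  shows "lp_resolvent p T z x = shift_resolvent w z x"
proof -
  have "inj_on (scalar_minus z T) (lp p)"
    using resolvent_left_inverse[OF z] by (metis inj_onI)
  then have "inv_into (lp p) (scalar_minus z T) (scalar_minus z T (shift_resolvent w z x))
      = shift_resolvent w z x"
    by (intro inv_into_f_f shift_resolvent_in_lp x)
  then show ?thesis
    by (simp add: lp_resolvent_def resolvent_right_inverse z x)
qed

lemma shift_resolvent_scale:
  assumes "x \<in> lp p"
  shows "shift_resolvent w z (\<lambda>n. c * x n) = (\<lambda>n. c * shift_resolvent w z x n)"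
  unfolding shift_resolvent_def using resolvent_term_summable'[OF assms]
  by (simp add: suminf_mult[symmetric] mult_ac)

lemma bounded_shift_resolvent: "lp_bounded_operator p (shift_resolvent w z)"
proof -
  obtain C where C: "0 < C" "\<And>n k. weight_product w n k \<le> C * 2 ^ k / fact k"
    using weight_product_upper[of 2] by auto
  have "shift_resolvent w z (\<lambda>n. x n + y n) = (\<lambda>n. shift_resolvent w z x n + shift_resolvent w z y n)"
    if "x \<in> lp p" "y \<in> lp p" for x y
    unfolding shift_resolvent_def using resolvent_term_summable' that
    by (simp add: suminf_add add_divide_distrib distrib_left)
  then show ?thesis
    unfolding lp_bounded_operator_def
    using shift_resolvent_in_lp shift_resolvent_scale resolvent_bound(2)[OF C(1) _ C(2)]
    by (auto intro!: exI[of _ "C / norm z * exp (2 / norm z)"])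
qed

lemma quasinilpotent: "lp_quasinilpotent p T"
proof -
  have "z \<notin> lp_spectrum p T" if "z \<noteq> 0" for z
    unfolding lp_spectrum_def
    using bounded_shift_resolvent[of z] resolvent_left_inverse[OF that] resolvent_right_inverse[OF that]
    by blast
  moreover have "0 \<in> lp_spectrum p T"
    unfolding lp_spectrum_def
  proof (clarify)
    fix S
    assume S: "lp_bounded_operator p S" "\<forall>x\<in>lp p. S (scalar_minus 0 T x) = x"
    have basis: "lp_basis 0 \<in> lp p" by (rule lp_finite_support) (simp add: lp_basis_def)
    have "scalar_minus 0 T (lp_basis 0) = (\<lambda>n. 0)"
      using T by (simp add: scalar_minus_def backward_weighted_shift_def)
    then have "S (\<lambda>n. 0) = lp_basis 0"
      using S(2) basis by metis
    moreover have "S (\<lambda>n. 0 * lp_basis 0 n) = (\<lambda>n. 0 * S (lp_basis 0) n)"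
      using S(1) basis unfolding lp_bounded_operator_def by blast
    ultimately have "lp_basis 0 0 = 0" by simp
    then show False by (simp add: lp_basis_def)
  qed
  ultimately show ?thesis
    using bounded_T by (auto simp: lp_quasinilpotent_def)
qed

end

section \<open>Logarithmic asymptotics\<close>

text \<open>
  Bounds of the shape \<open>C / r * exp (s / r)\<close> matter only through \<open>s\<close>: after taking logarithms
  and multiplying by \<open>r\<close>, the factor \<open>C / r\<close> contributes \<open>r ln C - r ln r \<rightarrow> 0\<close>.
\<close>

lemma log_exp_bound_tendsto:
  fixes C s :: real
  assumes C: "0 < C"
  shows "((\<lambda>r. r * ln (C / r * exp (s / r))) \<longlongrightarrow> s) (at_right 0)"
proof -
  have "((\<lambda>r::real. ln (inverse r) / inverse r) \<longlongrightarrow> 0) (at_right 0)"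
    by (rule filterlim_compose[OF ln_x_over_x_tendsto_0 filterlim_inverse_at_top_right])
  moreover have "((\<lambda>r::real. r * ln C) \<longlongrightarrow> 0 * ln C) (at_right 0)"
    by (intro tendsto_intros)
  ultimately have "((\<lambda>r. r * ln C + ln (inverse r) / inverse r + s) \<longlongrightarrow> 0 * ln C + 0 + s) (at_right 0)"
    by (intro tendsto_add tendsto_const)
  moreover have "\<forall>\<^sub>F r in at_right 0. r * ln C + ln (inverse r) / inverse r + s = r * ln (C / r * exp (s / r))"
    using eventually_at_right_less[of "0::real"]
  proof eventually_elim
    case (elim r)
    then show ?case using C by (simp add: ln_mult ln_div ln_inverse field_simps)
  qed
  ultimately show ?thesis by (simp add: tendsto_cong)
qed

lemma norm_at_right_0: "filterlim norm (at_right 0) (at (0::complex))"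
  unfolding filterlim_at
  by (intro conjI tendsto_norm_zero tendsto_ident_at)
    (auto simp: eventually_at_filter)

lemma of_real_at_0: "filterlim complex_of_real (at 0) (at_right 0)"
  unfolding filterlim_at
  by (auto intro!: tendsto_eq_intros simp: eventually_at_filter)

text \<open>
  Approaching 0 along the positive real axis is enough to bound the upper limit from below.
\<close>

lemma Limsup_at_0_ge_real:
  fixes f :: "complex \<Rightarrow> 'a::complete_lattice"
  shows "Limsup (at_right 0) (\<lambda>r. f (complex_of_real r)) \<le> Limsup (at 0) f"
proof (rule Limsup_greatest)
  fix P assume P: "eventually P (at (0::complex))"
  have "eventually (\<lambda>r. P (complex_of_real r)) (at_right 0)"
    using of_real_at_0 P by (simp add: filterlim_iff)
  then have "Limsup (at_right 0) (\<lambda>r. f (complex_of_real r)) \<le> (SUP r\<in>{r. P (complex_of_real r)}. f (complex_of_real r))"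
    unfolding Limsup_def by (intro INF_lower) simp
  also have "\<dots> \<le> (SUP z\<in>Collect P. f z)"
    by (rule SUP_mono) auto
  finally show "Limsup (at_right 0) (\<lambda>r. f (complex_of_real r)) \<le> (SUP z\<in>Collect P. f z)" .
qed

section \<open>Probing vectors\<close>

text \<open>
  The geometric factor \<open>t ^ k\<close> makes the resolvent grow like \<open>exp (t / norm z)\<close>, and the
  summable factor keeps the vector in \<open>\<ell>\<^sup>p\<close> even for \<open>t = 1\<close>. For \<open>t = 0\<close> and \<open>u = 1\<close> this is the
  basis vector with index 0, since \<open>0 ^ 0 = 1\<close>. The phases \<open>u ^ (k + 1)\<close> serve to cancel those of
  \<open>z ^ (k + 1)\<close> in the Neumann series when \<open>u = sgn z\<close>.
\<close>

definition probe :: "complex \<Rightarrow> real \<Rightarrow> nat \<Rightarrow> complex" where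
  "probe u t k = u ^ (k + 1) * complex_of_real (t ^ k / (real k + 1)\<^sup>2)"

lemma probe_nonzero: "probe 1 t \<noteq> (\<lambda>n. 0)"
proof
  assume "probe 1 t = (\<lambda>n. 0)"
  then have "probe 1 t 0 = 0" by simp
  then show False by (simp add: probe_def)
qed

lemma norm_probe: "norm u = 1 \<Longrightarrow> 0 \<le> t \<Longrightarrow> norm (probe u t k) = t ^ k / (real k + 1)\<^sup>2"
  unfolding probe_def norm_mult norm_power norm_of_real by simp

lemma probe_in_lp:
  assumes p: "1 \<le> p" and u: "norm u = 1" and t: "0 \<le> t" "t \<le> 1"
  shows "probe u t \<in> lp p"
proof -
  have s: "summable (\<lambda>k. inverse (real k + 1) ^ 2)"
    using summable_Suc_iff[of "\<lambda>k. inverse (real k ^ 2)"] inverse_power_summable[of 2, where 'a = real]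
    by (simp add: power_inverse add.commute)
  have "norm (probe u t k) powr p \<le> inverse (real k + 1) ^ 2" for k
  proof -
    have le: "norm (probe u t k) \<le> 1 / (real k + 1)\<^sup>2"
      unfolding norm_probe[OF u t(1)] using t by (intro divide_right_mono power_le_one) auto
    moreover from le have "norm (probe u t k) \<le> 1"
      by (rule order_trans) (simp add: divide_le_eq_1)
    ultimately have "norm (probe u t k) powr p \<le> norm (probe u t k) powr 1"
      using p by (intro powr_mono') auto
    also have "\<dots> \<le> 1 / (real k + 1)\<^sup>2" using le by simp
    finally show ?thesis by (simp add: power_inverse inverse_eq_divide power_one_over)
  qed
  then show ?thesis
    unfolding lp_def mem_Collect_eq
    by (intro summable_comparison_test'[OF s, of 0]) simp
qed

lemma lp_norm_probe:
  assumes "norm u = 1" "0 \<le> t"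
  shows "lp_norm p (probe u t) = lp_norm p (probe 1 t)"
  using assms by (simp add: lp_norm_def norm_probe)

lemma probe_shift_le:
  assumes "norm u = 1" "0 \<le> t"
  shows "norm (probe u t (n + k)) \<le> t ^ k * norm (probe u t n)"
proof -
  have "t ^ (n + k) / (real (n + k) + 1)\<^sup>2 \<le> t ^ (n + k) / (real n + 1)\<^sup>2"
    using assms by (intro divide_left_mono power_mono) auto
  then show ?thesis using assms by (simp add: norm_probe power_add mult_ac)
qed

context harmonic_shift
begin

text \<open>
  Since shifting \<open>probe u t\<close> by \<open>k\<close> costs a factor \<open>t ^ k\<close> in every coordinate, the resolvent
  maps it to a vector dominated pointwise by a multiple of itself, and the multiple is an
  exponential series in \<open>Q * t / norm z\<close>.
\<close>

lemma resolvent_probe_upper: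
  assumes C: "0 < C" "0 < Q" "\<And>n k. weight_product w n k \<le> C * Q ^ k / fact k"
    and t: "0 \<le> t" "t \<le> 1" and u: "norm u = 1"
  shows "lp_norm p (shift_resolvent w z (probe u t))
    \<le> C / norm z * exp (Q * t / norm z) * lp_norm p (probe u t)"
proof (rule lp_dominated(2)[OF p probe_in_lp[OF p u t]])
  show "0 \<le> C / norm z * exp (Q * t / norm z)" using C by simp
  fix n
  let ?a = "\<lambda>k. C * (Q * t) ^ k / fact k / norm z ^ (k + 1)"
  have a: "?a sums (C / norm z * exp (Q * t / norm z))"
    by (rule exp_majorant_sums)
  have "norm (shift_resolvent w z (probe u t) n) \<le> (\<Sum>k. ?a k * norm (probe u t n))"
    unfolding shift_resolvent_def
  proof (rule norm_suminf_le)
    show "summable (\<lambda>k. ?a k * norm (probe u t n))"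
      using sums_summable[OF a] by (rule summable_mult2)
    fix k
    have "norm (complex_of_real (weight_product w n k) * probe u t (n + k) / z ^ (k + 1))
        \<le> C * Q ^ k / fact k / norm z ^ (k + 1) * norm (probe u t (n + k))"
      by (rule norm_resolvent_term[OF C(3)])
    also have "\<dots> \<le> C * Q ^ k / fact k / norm z ^ (k + 1) * (t ^ k * norm (probe u t n))"
      using C probe_shift_le[OF u t(1)] by (intro mult_left_mono) auto
    finally show "norm (complex_of_real (weight_product w n k) * probe u t (n + k) / z ^ (k + 1))
        \<le> ?a k * norm (probe u t n)"
      by (simp add: power_mult_distrib mult_ac)
  qed
  also have "\<dots> = C / norm z * exp (Q * t / norm z) * norm (probe u t n)"
    using sums_mult2[OF a] by (simp add: sums_iff)
  finally show "norm (shift_resolvent w z (probe u t) n)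
      \<le> C / norm z * exp (Q * t / norm z) * norm (probe u t n)" .
qed

text \<open>
  With the phase \<open>sgn z\<close> all terms of the series for coordinate 0 are nonnegative, so no
  cancellation occurs and this coordinate alone is as large as an exponential.
\<close>

lemma resolvent_probe_lower:
  assumes c: "\<And>k. c * q ^ k / fact k \<le> weight_product w 0 k / (real k + 1)\<^sup>2"
    and t: "0 \<le> t" "t \<le> 1" and z: "z \<noteq> 0"
  shows "c / norm z * exp (q * t / norm z) \<le> lp_norm p (shift_resolvent w z (probe (sgn z) t))"
proof -
  have u: "norm (sgn z) = 1" using z by (simp add: norm_sgn)
  note x = probe_in_lp[OF p u t]
  have "sgn z / z = complex_of_real (1 / norm z)"
    using z by (simp add: sgn_eq)
  then have uz: "sgn z ^ k / z ^ k = complex_of_real (1 / norm z ^ k)" for k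
    unfolding power_divide[symmetric] by (simp add: power_one_over)
  let ?f = "\<lambda>k. weight_product w 0 k / (real k + 1)\<^sup>2 * t ^ k / norm z ^ (k + 1)"
  have f: "complex_of_real (weight_product w 0 k) * probe (sgn z) t (0 + k) / z ^ (k + 1)
      = complex_of_real (?f k)" for k
  proof -
    have "complex_of_real (weight_product w 0 k) * probe (sgn z) t (0 + k) / z ^ (k + 1)
        = complex_of_real (weight_product w 0 k) * complex_of_real (t ^ k / (real k + 1)\<^sup>2)
            * (sgn z ^ (k + 1) / z ^ (k + 1))"
      by (simp add: probe_def)
    then show ?thesis unfolding uz by simp
  qed
  have sf: "summable ?f"
    using resolvent_term_summable[OF x, of 0 z] unfolding f norm_of_real by (rule summable_rabs_cancel)
  have "(\<Sum>k. c * (q * t) ^ k / fact k / norm z ^ (k + 1)) \<le> (\<Sum>k. ?f k)"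
  proof (rule suminf_le[OF _ sums_summable[OF exp_majorant_sums] sf])
    fix k
    have "c * q ^ k / fact k * (t ^ k / norm z ^ (k + 1))
        \<le> weight_product w 0 k / (real k + 1)\<^sup>2 * (t ^ k / norm z ^ (k + 1))"
      using t by (intro mult_right_mono c) auto
    then show "c * (q * t) ^ k / fact k / norm z ^ (k + 1) \<le> ?f k"
      by (simp add: power_mult_distrib mult_ac)
  qed
  then have "c / norm z * exp (q * t / norm z) \<le> (\<Sum>k. ?f k)"
    using sums_unique[OF exp_majorant_sums[of c "q * t" "norm z"]] by simp
  also have "\<dots> \<le> norm (shift_resolvent w z (probe (sgn z) t) 0)"
    unfolding shift_resolvent_def f suminf_of_real[OF sf, symmetric] norm_of_real by (rule abs_ge_self)
  also have "\<dots> \<le> lp_norm p (shift_resolvent w z (probe (sgn z) t))"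
    by (rule norm_le_lp_norm[OF p shift_resolvent_in_lp[OF x]])
  finally show ?thesis .
qed

section \<open>Growth of the resolvent\<close>

lemma lp_onorm_resolvent_le:
  assumes C: "0 < C" "0 < Q" "\<And>n k. weight_product w n k \<le> C * Q ^ k / fact k"
    and z: "z \<noteq> 0"
  shows "lp_onorm p (lp_resolvent p T z) \<le> C / norm z * exp (Q / norm z)"
    and "bdd_above ((\<lambda>x. lp_norm p (lp_resolvent p T z x)) ` {x \<in> lp p. lp_norm p x \<le> 1})"
proof -
  have le: "lp_norm p (lp_resolvent p T z x) \<le> C / norm z * exp (Q / norm z)"
    if "x \<in> {x \<in> lp p. lp_norm p x \<le> 1}" for x
  proof -
    have "lp_norm p (lp_resolvent p T z x) \<le> C / norm z * exp (Q / norm z) * lp_norm p x"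
      using that z resolvent_bound(2)[OF C, of x z] by (simp add: lp_resolvent_eq)
    also have "\<dots> \<le> C / norm z * exp (Q / norm z) * 1"
      using that C by (intro mult_left_mono) auto
    finally show ?thesis by simp
  qed
  then show "bdd_above ((\<lambda>x. lp_norm p (lp_resolvent p T z x)) ` {x \<in> lp p. lp_norm p x \<le> 1})"
    by (auto intro!: bdd_aboveI)
  have "(\<lambda>n. 0) \<in> {x \<in> lp p. lp_norm p x \<le> 1}"
    by (simp add: lp_finite_support lp_norm_def)
  then show "lp_onorm p (lp_resolvent p T z) \<le> C / norm z * exp (Q / norm z)"
    unfolding lp_onorm_def using le by (intro cSUP_least) auto
qed

lemma resolvent_norm_le_onorm:
  assumes z: "z \<noteq> 0" and x: "x \<in> lp p"
  shows "lp_norm p (shift_resolvent w z x) \<le> lp_onorm p (lp_resolvent p T z) * lp_norm p x"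
proof (cases "x = (\<lambda>n. 0)")
  case True
  have "shift_resolvent w z (\<lambda>n. 0) = (\<lambda>n. 0)" by (simp add: shift_resolvent_def fun_eq_iff)
  then show ?thesis using True p by (simp add: lp_norm_def)
next
  case False
  let ?X = "lp_norm p x"
  have X: "0 < ?X" by (rule lp_norm_pos[OF p x False])
  define y where "y = (\<lambda>n. complex_of_real (1 / ?X) * x n)"
  have y: "y \<in> lp p" "lp_norm p y \<le> 1"
    using lp_scale[OF p x, of "complex_of_real (1 / ?X)"] X by (simp_all add: y_def norm_divide)
  obtain C where C: "0 < C" "\<And>n k. weight_product w n k \<le> C * 2 ^ k / fact k"
    using weight_product_upper[of 2] by auto
  have "lp_norm p (shift_resolvent w z y) \<le> lp_onorm p (lp_resolvent p T z)"
    unfolding lp_onorm_def lp_resolvent_eq[OF z y(1), symmetric]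
    using y by (intro cSUP_upper lp_onorm_resolvent_le(2)[OF C(1) _ C(2) z]) auto
  have "x = (\<lambda>n. complex_of_real ?X * y n)" using X by (simp add: y_def)
  then have "shift_resolvent w z x = (\<lambda>n. complex_of_real ?X * shift_resolvent w z y n)"
    using shift_resolvent_scale[OF y(1)] by metis
  then have "lp_norm p (shift_resolvent w z x) \<le> ?X * lp_norm p (shift_resolvent w z y)"
    using lp_scale(2)[OF p shift_resolvent_in_lp[OF y(1), of z], of "complex_of_real ?X"] X by simp
  also have "\<dots> \<le> ?X * lp_onorm p (lp_resolvent p T z)"
    using X \<open>lp_norm p (shift_resolvent w z y) \<le> _\<close> by (intro mult_left_mono) auto
  finally show ?thesis by (simp add: mult.commute)
qed

text \<open>
  Needed because \<open>ln\<close> is monotone only on positive numbers.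
\<close>

lemma resolvent_norm_pos:
  assumes "z \<noteq> 0" "x \<in> lp p" "x \<noteq> (\<lambda>n. 0)"
  shows "0 < lp_norm p (shift_resolvent w z x)"
proof (rule lp_norm_pos[OF p shift_resolvent_in_lp[OF assms(2)]])
  show "shift_resolvent w z x \<noteq> (\<lambda>n. 0)"
  proof
    assume "shift_resolvent w z x = (\<lambda>n. 0)"
    moreover have "scalar_minus z T (\<lambda>n. 0) = (\<lambda>n. 0)"
      by (simp add: scalar_minus_def T_apply lp_finite_support fun_eq_iff)
    ultimately show False using resolvent_right_inverse[OF assms(1,2)] assms(3) by simp
  qed
qed

lemma onorm_resolvent_pos:
  assumes z: "z \<noteq> 0"
  shows "0 < lp_onorm p (lp_resolvent p T z)"
proof -
  have x: "lp_basis 0 \<in> lp p" by (rule lp_finite_support) (simp add: lp_basis_def)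
  have "lp_basis 0 \<noteq> (\<lambda>n. 0)" by (auto simp: lp_basis_def fun_eq_iff)
  from resolvent_norm_pos[OF z x this] resolvent_norm_le_onorm[OF z x]
  have "0 < lp_onorm p (lp_resolvent p T z) * lp_norm p (lp_basis 0)" by linarith
  then show ?thesis using lp_norm_nonneg[of p "lp_basis 0"] by (simp add: zero_less_mult_iff)
qed

lemma eventually_at_0_ne: "\<forall>\<^sub>F z in at (0::complex). z \<noteq> 0"
  by (simp add: eventually_at_filter)

text \<open>
  The resolvent norm grows like \<open>exp (1 / norm z)\<close> in every direction: from above by the
  Neumann series, and from below by testing with \<open>probe (sgn z) 1\<close>, whose norm does not depend
  on \<open>z\<close>. Consequently \<open>norm z * ln (norm of the resolvent vector)\<close> may replace the quotient in the
  definition of the local power.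
\<close>

lemma log_onorm_resolvent_tendsto:
  "((\<lambda>z. norm z * ln (lp_onorm p (lp_resolvent p T z))) \<longlongrightarrow> 1) (at 0)"
proof (rule order_tendstoI)
  fix b :: real assume "1 < b"
  then obtain Q where Q: "1 < Q" "Q < b" using dense by blast
  obtain C where C: "0 < C" "\<And>n k. weight_product w n k \<le> C * Q ^ k / fact k"
    using weight_product_upper[OF Q(1)] by auto
  have "((\<lambda>z. norm z * ln (C / norm z * exp (Q / norm z))) \<longlongrightarrow> Q) (at (0::complex))"
    by (rule filterlim_compose[OF log_exp_bound_tendsto[OF C(1)] norm_at_right_0])
  then have "\<forall>\<^sub>F z in at (0::complex). norm z * ln (C / norm z * exp (Q / norm z)) < b"
    using Q(2) by (rule order_tendstoD)
  then show "\<forall>\<^sub>F z in at 0. norm z * ln (lp_onorm p (lp_resolvent p T z)) < b"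
    using eventually_at_0_ne
  proof eventually_elim
    case (elim z)
    have "ln (lp_onorm p (lp_resolvent p T z)) \<le> ln (C / norm z * exp (Q / norm z))"
      using lp_onorm_resolvent_le(1)[OF C(1) _ C(2) elim(2)] Q(1) onorm_resolvent_pos[OF elim(2)]
      by (intro ln_mono) auto
    from mult_left_mono[OF this norm_ge_zero[of z]] show ?case using elim(1) by linarith
  qed
next
  fix b :: real assume "b < 1"
  then obtain q where "max b 0 < q" "q < 1" using dense[of "max b 0" 1] by auto
  then have q: "0 < q" "q < 1" "b < q" by auto
  obtain c where c: "0 < c" "\<And>k. c * q ^ k / fact k \<le> weight_product w 0 k / (real k + 1)\<^sup>2"
    using weight_product_lower[OF q(1,2)] by auto
  define K where "K = lp_norm p (probe 1 1)"
  have K: "0 < K"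
    unfolding K_def by (intro lp_norm_pos p probe_in_lp probe_nonzero) auto
  have "((\<lambda>z. norm z * ln (c / K / norm z * exp (q / norm z))) \<longlongrightarrow> q) (at (0::complex))"
    using c K by (intro filterlim_compose[OF log_exp_bound_tendsto norm_at_right_0]) auto
  then have "\<forall>\<^sub>F z in at (0::complex). b < norm z * ln (c / K / norm z * exp (q / norm z))"
    using q(3) by (rule order_tendstoD)
  then show "\<forall>\<^sub>F z in at 0. b < norm z * ln (lp_onorm p (lp_resolvent p T z))"
    using eventually_at_0_ne
  proof eventually_elim
    case (elim z)
    have u: "norm (sgn z) = 1" using elim by (simp add: norm_sgn)
    have "c / norm z * exp (q * 1 / norm z) \<le> lp_norm p (shift_resolvent w z (probe (sgn z) 1))"
      using elim by (intro resolvent_probe_lower c) auto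
    also have "\<dots> \<le> lp_onorm p (lp_resolvent p T z) * lp_norm p (probe (sgn z) 1)"
      using elim u p by (intro resolvent_norm_le_onorm probe_in_lp) auto
    also have "lp_norm p (probe (sgn z) 1) = K"
      unfolding K_def using u by (intro lp_norm_probe) auto
    finally have "(c / norm z * exp (q * 1 / norm z)) / K \<le> lp_onorm p (lp_resolvent p T z)"
      using K by (simp only: pos_divide_le_eq)
    then have "c / K / norm z * exp (q / norm z) \<le> lp_onorm p (lp_resolvent p T z)"
      by (simp add: mult.commute)
    then have "ln (c / K / norm z * exp (q / norm z)) \<le> ln (lp_onorm p (lp_resolvent p T z))"
      using c K elim by (intro ln_mono) auto
    from mult_left_mono[OF this norm_ge_zero[of z]] show ?case using elim(1) by linarith
  qed
qed

section \<open>Local powers\<close>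

lemma log_onorm_resolvent_pos: "\<forall>\<^sub>F z in at 0. 0 < norm z * ln (lp_onorm p (lp_resolvent p T z))"
  using log_onorm_resolvent_tendsto by (rule order_tendstoD) simp

lemma local_power_le:
  assumes h: "(h \<longlongrightarrow> s) (at 0)" and x: "x \<in> lp p"
    and le: "\<And>z. z \<noteq> 0 \<Longrightarrow> norm z * ln (lp_norm p (shift_resolvent w z x)) \<le> h z"
  shows "local_power p T x \<le> ereal s"
proof -
  let ?g = "\<lambda>z. norm z * ln (lp_onorm p (lp_resolvent p T z))"
  have "((\<lambda>z. ereal (h z / ?g z)) \<longlongrightarrow> ereal (s / 1)) (at 0)"
    by (intro tendsto_intros h log_onorm_resolvent_tendsto) auto
  then have "Limsup (at 0) (\<lambda>z. ereal (h z / ?g z)) = ereal s"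
    by (intro lim_imp_Limsup) auto
  moreover have "local_power p T x \<le> Limsup (at 0) (\<lambda>z. ereal (h z / ?g z))"
    unfolding local_power_def
  proof (rule Limsup_mono)
    show "\<forall>\<^sub>F z in at 0. ereal (ln (lp_norm p (lp_resolvent p T z x)) / ln (lp_onorm p (lp_resolvent p T z)))
        \<le> ereal (h z / ?g z)"
      using eventually_at_0_ne log_onorm_resolvent_pos
    proof eventually_elim
      case (elim z)
      have "norm z * ln (lp_norm p (shift_resolvent w z x)) / ?g z \<le> h z / ?g z"
        using elim by (intro divide_right_mono le) auto
      then show ?case using elim(1) by (simp add: lp_resolvent_eq x)
    qed
  qed
  ultimately show ?thesis by simp
qed

lemma local_power_ge:
  assumes h: "(h \<longlongrightarrow> s) (at_right 0)" and x: "x \<in> lp p"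
    and le: "\<forall>\<^sub>F r in at_right 0. h r \<le> r * ln (lp_norm p (shift_resolvent w (complex_of_real r) x))"
  shows "ereal s \<le> local_power p T x"
proof -
  let ?N = "\<lambda>r. lp_onorm p (lp_resolvent p T (complex_of_real r))"
  have "((\<lambda>r. norm (complex_of_real r) * ln (?N r)) \<longlongrightarrow> 1) (at_right 0)"
    by (rule filterlim_compose[OF log_onorm_resolvent_tendsto of_real_at_0])
  moreover have "\<forall>\<^sub>F r in at_right 0. norm (complex_of_real r) * ln (?N r) = r * ln (?N r)"
    using eventually_at_right_less[of "0::real"] by eventually_elim simp
  ultimately have g: "((\<lambda>r. r * ln (?N r)) \<longlongrightarrow> 1) (at_right 0)"
    by (rule Lim_transform_eventually)
  have "((\<lambda>r. ereal (h r / (r * ln (?N r)))) \<longlongrightarrow> ereal (s / 1)) (at_right 0)"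
    by (intro tendsto_intros h g) auto
  then have "ereal s = Limsup (at_right 0) (\<lambda>r. ereal (h r / (r * ln (?N r))))"
    by (intro lim_imp_Limsup[symmetric]) auto
  also have "\<dots> \<le> Limsup (at_right 0) (\<lambda>r. ereal (ln (lp_norm p (lp_resolvent p T (complex_of_real r) x)) / ln (?N r)))"
  proof (rule Limsup_mono)
    have "\<forall>\<^sub>F r in at_right 0. 0 < r * ln (?N r)"
      using g by (rule order_tendstoD) simp
    then show "\<forall>\<^sub>F r in at_right 0. ereal (h r / (r * ln (?N r)))
        \<le> ereal (ln (lp_norm p (lp_resolvent p T (complex_of_real r) x)) / ln (?N r))"
      using le eventually_at_right_less[of "0::real"]
    proof eventually_elim
      case (elim r)
      have "h r / (r * ln (?N r))
          \<le> r * ln (lp_norm p (shift_resolvent w (complex_of_real r) x)) / (r * ln (?N r))"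
        using elim by (intro divide_right_mono) auto
      then show ?case using elim(3) by (simp add: lp_resolvent_eq x)
    qed
  qed
  also have "\<dots> \<le> local_power p T x"
    unfolding local_power_def by (rule Limsup_at_0_ge_real)
  finally show ?thesis .
qed

lemma local_power_le_exp:
  assumes K: "0 < K" and x: "x \<in> lp p" "x \<noteq> (\<lambda>n. 0)"
    and le: "\<And>z. z \<noteq> 0 \<Longrightarrow> lp_norm p (shift_resolvent w z x) \<le> K / norm z * exp (s / norm z)"
  shows "local_power p T x \<le> ereal s"
proof (rule local_power_le[OF filterlim_compose[OF log_exp_bound_tendsto[OF K] norm_at_right_0] x(1)])
  fix z :: complex assume z: "z \<noteq> 0"
  show "norm z * ln (lp_norm p (shift_resolvent w z x)) \<le> norm z * ln (K / norm z * exp (s / norm z))"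
    using le[OF z] resolvent_norm_pos[OF z x] by (intro mult_left_mono ln_mono) auto
qed

lemma local_power_le_1:
  assumes x: "x \<in> lp p" "x \<noteq> (\<lambda>n. 0)"
  shows "local_power p T x \<le> 1"
proof -
  have le: "local_power p T x \<le> ereal Q" if Q: "1 < Q" for Q
  proof -
    obtain C where C: "0 < C" "\<And>n k. weight_product w n k \<le> C * Q ^ k / fact k"
      using weight_product_upper[OF Q] by auto
    show ?thesis
      using resolvent_bound(2)[OF C(1) _ C(2) x(1)] C(1) lp_norm_pos[OF p x] Q
      by (intro local_power_le_exp[of "C * lp_norm p x"] x) (auto simp: mult_ac)
  qed
  show ?thesis
  proof (rule dense_ge)
    fix b :: ereal assume b: "1 < b"
    then show "local_power p T x \<le> b"
      using le by (cases b) auto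
  qed
qed

text \<open>
  The resolvent vectors \<open>y\<close> cannot become small: a coordinate of \<open>x = z y - T y\<close> involves
  only two coordinates of \<open>y\<close>, with bounded coefficients. The logarithm is thus bounded below,
  while that of the resolvent norm tends to infinity.
\<close>

lemma local_power_ge_0:
  assumes x: "x \<in> lp p" "x \<noteq> (\<lambda>n. 0)"
  shows "0 \<le> local_power p T x"
proof -
  obtain n where n: "x n \<noteq> 0" using x(2) by auto
  \<comment> \<open>The denominator bounds \<open>norm z + w (n + 1)\<close> for \<open>norm z < 1\<close>.\<close>
  define K where "K = norm (x n) / (1 + w (n + 1))"
  have w1: "0 < w (n + 1)" by (rule w_pos) simp
  then have K: "0 < K" using n by (simp add: K_def)
  have "((\<lambda>r::real. r * ln K) \<longlongrightarrow> 0 * ln K) (at_right 0)"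
    by (intro tendsto_intros)
  then have "ereal (0 * ln K) \<le> local_power p T x"
  proof (rule local_power_ge[OF _ x(1)])
    have "\<forall>\<^sub>F r in at_right (0::real). r < 1"
      by (rule eventually_at_rightI[of 0 1]) auto
    then show "\<forall>\<^sub>F r in at_right 0. r * ln K \<le> r * ln (lp_norm p (shift_resolvent w (complex_of_real r) x))"
      using eventually_at_right_less[of "0::real"]
    proof eventually_elim
      case (elim r)
      let ?y = "shift_resolvent w (complex_of_real r) x"
      have y: "?y \<in> lp p" by (rule shift_resolvent_in_lp[OF x(1)])
      have "x n = r * ?y n - w (n + 1) * ?y (n + 1)"
        using fun_cong[OF resolvent_right_inverse[OF _ x(1), of "complex_of_real r"], of n] elim
        by (simp add: scalar_minus_def T_apply[OF y])
      then have "norm (x n) \<le> norm (r * ?y n) + norm (w (n + 1) * ?y (n + 1))"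
        using norm_triangle_ineq4 by metis
      also have "\<dots> = r * norm (?y n) + w (n + 1) * norm (?y (n + 1))"
        using elim w1 by (simp add: norm_mult)
      also have "\<dots> \<le> 1 * lp_norm p ?y + w (n + 1) * lp_norm p ?y"
        using elim w1 norm_le_lp_norm[OF p y] by (intro add_mono mult_mono) auto
      finally have "K \<le> lp_norm p ?y"
        using w1 by (simp add: K_def divide_le_eq algebra_simps)
      then show ?case using K elim by (intro mult_left_mono ln_mono) auto
    qed
  qed
  then show ?thesis by (simp add: zero_ereal_def)
qed

text \<open>
  The bounds on the resolvent of \<open>probe 1 t\<close> have exponents \<open>Q * t\<close> and \<open>q * t\<close> for all
  \<open>q < 1 < Q\<close>; letting \<open>Q\<close> and \<open>q\<close> tend to 1 closes the gap. On the positive real axis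
  \<open>sgn z = 1\<close>, so the lower bound applies to this one vector.
\<close>

lemma local_power_probe:
  assumes t: "0 \<le> t" "t \<le> 1"
  shows "local_power p T (probe 1 t) = ereal t"
proof (rule antisym)
  have x: "probe 1 t \<in> lp p" using t by (intro probe_in_lp p) auto
  note x0 = probe_nonzero
  show "local_power p T (probe 1 t) \<le> ereal t"
  proof (rule tendsto_lowerbound[of "\<lambda>Q. ereal (Q * t)" _ "at_right 1"])
    show "((\<lambda>Q. ereal (Q * t)) \<longlongrightarrow> ereal t) (at_right 1)"
      by (auto intro!: tendsto_eq_intros)
    show "\<forall>\<^sub>F Q in at_right 1. local_power p T (probe 1 t) \<le> ereal (Q * t)"
      using eventually_at_right_less[of "1::real"]
    proof eventually_elim
      case (elim Q)
      obtain C where C: "0 < C" "\<And>n k. weight_product w n k \<le> C * Q ^ k / fact k"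
        using weight_product_upper[OF elim] by auto
      show ?case
        using resolvent_probe_upper[OF C(1) _ C(2) t, of 1] C(1) lp_norm_pos[OF p x x0] elim
        by (intro local_power_le_exp[of "C * lp_norm p (probe 1 t)"] x x0) (auto simp: mult_ac)
    qed
  qed simp
  show "ereal t \<le> local_power p T (probe 1 t)"
  proof (rule tendsto_upperbound[of "\<lambda>q. ereal (q * t)" _ "at_left 1"])
    show "((\<lambda>q. ereal (q * t)) \<longlongrightarrow> ereal t) (at_left 1)"
      by (auto intro!: tendsto_eq_intros)
    have "\<forall>\<^sub>F q in at_left (1::real). q \<in> {0<..<1}"
      by (rule eventually_at_leftI[of 0]) auto
    then show "\<forall>\<^sub>F q in at_left 1. ereal (q * t) \<le> local_power p T (probe 1 t)"
    proof eventually_elim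
      case (elim q)
      then have q: "0 < q" "q < 1" by auto
      obtain c where c: "0 < c" "\<And>k. c * q ^ k / fact k \<le> weight_product w 0 k / (real k + 1)\<^sup>2"
        using weight_product_lower[OF q] by auto
      show ?case
      proof (rule local_power_ge[OF log_exp_bound_tendsto[OF c(1)] x])
        show "\<forall>\<^sub>F r in at_right 0. r * ln (c / r * exp (q * t / r))
            \<le> r * ln (lp_norm p (shift_resolvent w (complex_of_real r) (probe 1 t)))"
          using eventually_at_right_less[of "0::real"]
        proof eventually_elim
          case (elim r)
          have "sgn (complex_of_real r) = 1" using elim by (simp add: sgn_of_real)
          then have "c / r * exp (q * t / r) \<le> lp_norm p (shift_resolvent w (complex_of_real r) (probe 1 t))"
            using resolvent_probe_lower[OF c(2) t, of "complex_of_real r"] elim by simp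
          then show ?case using c(1) elim by (intro mult_left_mono ln_mono) auto
        qed
      qed
    qed
  qed simp
qed

lemma power_set_eq: "power_set p T = ereal ` {0..1}"
proof (intro equalityI subsetI)
  fix l assume "l \<in> power_set p T"
  then have "0 \<le> l" "l \<le> 1"
    using local_power_ge_0 local_power_le_1 by (auto simp: power_set_def)
  then show "l \<in> ereal ` {0..1}" by (cases l) auto
next
  fix l assume "l \<in> ereal ` {0..1}"
  then obtain t where t: "l = ereal t" "0 \<le> t" "t \<le> 1" by auto
  have "probe 1 t \<in> lp p" using t by (intro probe_in_lp p) auto
  then show "l \<in> power_set p T"
    unfolding power_set_def mem_Collect_eq
    using local_power_probe[OF t(2,3)] t(1) probe_nonzero by (intro exI[of _ "probe 1 t"]) simp
qed

end

section \<open>Weights squeezed between reciprocals\<close>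

theorem theorem3p4:
  fixes p :: real
    and w :: "nat \<Rightarrow> real"
    and T :: "(nat \<Rightarrow> complex) \<Rightarrow> (nat \<Rightarrow> complex)"
    and m0 :: nat
  assumes "1 \<le> p"
    and "backward_weighted_shift p (\<lambda>n. complex_of_real (w n)) T"
    and "\<And>n. n \<ge> 1 \<Longrightarrow> w n > 0"
    and "m0 \<ge> 1"
    and "\<And>n. n \<ge> 1 \<Longrightarrow> 1 / (real n + 2 * real m0) \<le> w (n + m0)"
    and "\<And>n. n \<ge> 1 \<Longrightarrow> w (n + m0) \<le> 1 / real n"
  shows "lp_quasinilpotent p T \<and> power_set p T = ereal ` {0..1}"
proof -
  have lim: "(\<lambda>n. (real n + a) / (real n + b)) \<longlonglongrightarrow> 1" for a b :: real
  proof -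
    have b: "filterlim (\<lambda>n. real n + b) at_top sequentially"
      using filterlim_tendsto_add_at_top[OF tendsto_const filterlim_real_sequentially, of b]
      by (simp add: add.commute)
    have "(\<lambda>n. 1 + (a - b) / (real n + b)) \<longlonglongrightarrow> 1 + 0"
      by (intro tendsto_add tendsto_const tendsto_divide_0[OF tendsto_const]
          filterlim_at_top_imp_at_infinity b)
    moreover have "\<forall>\<^sub>F n in sequentially. 1 + (a - b) / (real n + b) = (real n + a) / (real n + b)"
      using filterlim_at_top_dense[THEN iffD1, OF b, rule_format, of 0]
      by eventually_elim (simp add: field_simps)
    ultimately show ?thesis by (simp add: tendsto_cong)
  qed
  \<comment> \<open>Both bounding quotients differ from 1 by a constant over a linear function of \<open>n\<close>.\<close>
  have "(\<lambda>n. real (n + m0) * w (n + m0)) \<longlonglongrightarrow> 1"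
  proof (rule tendsto_sandwich[OF _ _ lim lim])
    show "\<forall>\<^sub>F n in sequentially. (real n + real m0) / (real n + 2 * real m0) \<le> real (n + m0) * w (n + m0)"
      using eventually_ge_at_top[of "1::nat"]
    proof eventually_elim
      case (elim n)
      show ?case using mult_left_mono[OF assms(5)[OF elim], of "real (n + m0)"] by simp
    qed
    show "\<forall>\<^sub>F n in sequentially. real (n + m0) * w (n + m0) \<le> (real n + real m0) / (real n + 0)"
      using eventually_ge_at_top[of "1::nat"]
    proof eventually_elim
      case (elim n)
      show ?case using mult_left_mono[OF assms(6)[OF elim], of "real (n + m0)"] by simp
    qed
  qed
  then have "(\<lambda>n. real n * w n) \<longlonglongrightarrow> 1"
    by (rule LIMSEQ_offset)
  then interpret harmonic_shift w p T
    using assms(1-3) by unfold_locales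
  show ?thesis using quasinilpotent power_set_eq by simp
qed

end
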